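(* Let $I$ be a non-empty descent set, $s=s(I)$, $w=w(I)$, and $(C_0,\ldots,C_s)$ its Naruse-Newton coefficients. Then $$\frac{C_0}{0!}=\frac{C_1}{1!}=\cdots=\frac{C_w}{w!}>\frac{C_{w+1}}{(w+1)!}>\cdots>\frac{C_s}{s!};$$ that is, $\frac{C_j}{j!}=\frac{C_{j+1}}{(j+1)!}$ for all integers $0\le j<\min(w,s)$, and $\frac{C_j}{j!}>\frac{C_{j+1}}{(j+1)!}$ for all integers $w\le j<s$.
   Context: Partitions are drawn as Young diagrams $\mathbb{D}(\lambda)$ in English notation; $c_{i,j}$ is the cell in row $i$, column $j$; $\lambda'$ is the conjugate partition ($\lambda'_j$ = number of cells in column $j$). The hook length $h_\lambda(c)$ is the number of cells of $\mathbb{D}(\lambda)$ weakly right of $c$ in its row or weakly below $c$ in its column (counting $c$ once). For $\mu\subseteq\lambda$, an excited diagram of $\lambda/\mu$ is a subset of $\mathbb{D}(\lambda)$ obtained from $\mathbb{D}(\mu)$ by repeatedly replacing a cell $c_{i,j}\in D$ by $c_{i+1,j+1}$, allowed iff $c_{i+1,j+1}\in\mathbb{D}(\lambda)$ and none of $c_{i,j+1},c_{i+1,j},c_{i+1,j+1}$ lies in $D$; $\mathbb{E}(\lambda/\mu)$ is their set. A ribbon with $n$ cells is read from its lower-left to its upper-right cell, each successive cell directly right of or directly above the previous; it corresponds to the set of $i\in\{1,\ldots,n-1\}$ with cell $i$ directly below cell $i+1$. A descent set is a non-empty finite set $I$ of positive integers; $\lambda^I$ is the unique partition with $\lambda^I_1=\lambda^I_2$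 such that the cells $c_{i,j}\in\mathbb{D}(\lambda^I)$ with fewer than three of $c_{i,j+1},c_{i+1,j},c_{i+1,j+1}$ in $\mathbb{D}(\lambda^I)$ form a ribbon corresponding to $I$; this ribbon is $\mathbb{D}(\lambda^I)\setminus\mathbb{D}(\mu^I)$ for a partition $\mu^I$. Let $s(I)=\lambda^I_1-1$. Naruse-Newton coefficients: every excited diagram of $\lambda^I/\mu^I$ meets row 1 in $\{c_{1,1},\ldots,c_{1,r}\}$, $0\le r\le s$; for $0\le j\le s(I)$, $C_j(I)=\sum_D\prod_{c\in D,\,c\notin\text{row }1}h_{\lambda^I}(c)$, summed over $D\in\mathbb{E}(\lambda^I/\mu^I)$ with exactly $s-j$ cells in row 1. $w(I)$ is the number of integers $j$ with $1\le j\le s(I)+1$ and $(\lambda^I)'_j=2$. *)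

theory Defs
  imports Complex_Main
begin

text \<open>Partitions are nat lists, weakly decreasing, with positive parts.
  Cells are pairs (row, column), 1-indexed, English notation.\<close>

definition is_partition :: "nat list \<Rightarrow> bool" where
  "is_partition lam \<longleftrightarrow> sorted_wrt (\<ge>) lam \<and> 0 \<notin> set lam"

definition part :: "nat list \<Rightarrow> nat \<Rightarrow> nat" where
  "part lam i = (if 1 \<le> i \<and> i \<le> length lam then lam ! (i - 1) else 0)"

definition diagram :: "nat list \<Rightarrow> (nat \<times> nat) set" where
  "diagram lam = {(i, j). 1 \<le> i \<and> i \<le> length lam \<and> 1 \<le> j \<and> j \<le> lam ! (i - 1)}"

definition conj_part :: "nat list \<Rightarrow> nat \<Rightarrow> nat" where
  "conj_part lam j = card {i. (i, j) \<in> diagram lam}"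

definition hook :: "nat list \<Rightarrow> nat \<times> nat \<Rightarrow> nat" where
  "hook lam c = card {c' \<in> diagram lam.
      (fst c' = fst c \<and> snd c' \<ge> snd c) \<or> (snd c' = snd c \<and> fst c' \<ge> fst c)}"

inductive_set excited :: "nat list \<Rightarrow> nat list \<Rightarrow> (nat \<times> nat) set set"
  for lam mu where
  base: "diagram mu \<in> excited lam mu"
| step: "\<lbrakk> D \<in> excited lam mu; (i, j) \<in> D; (i + 1, j + 1) \<in> diagram lam;
           (i, j + 1) \<notin> D; (i + 1, j) \<notin> D; (i + 1, j + 1) \<notin> D \<rbrakk>
         \<Longrightarrow> insert (i + 1, j + 1) (D - {(i, j)}) \<in> excited lam mu"

definition ribbon_corr :: "(nat \<times> nat) set \<Rightarrow> nat set \<Rightarrow> bool" where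
  "ribbon_corr R I \<longleftrightarrow> (\<exists>(c :: nat \<Rightarrow> nat \<times> nat) n.
      inj_on c {1..n} \<and> R = c ` {1..n} \<and>
      (\<forall>k\<in>{1..<n}. c (k + 1) = (fst (c k), snd (c k) + 1)
                   \<or> (fst (c k) = fst (c (k + 1)) + 1 \<and> snd (c (k + 1)) = snd (c k))) \<and>
      I = {k \<in> {1..<n}. fst (c k) = fst (c (k + 1)) + 1 \<and> snd (c (k + 1)) = snd (c k)})"

definition rim :: "nat list \<Rightarrow> (nat \<times> nat) set" where
  "rim lam = {(i, j) \<in> diagram lam.
     card ({(i, j + 1), (i + 1, j), (i + 1, j + 1)} \<inter> diagram lam) < 3}"

definition is_descent_set :: "nat set \<Rightarrow> bool" where
  "is_descent_set I \<longleftrightarrow> I \<noteq> {} \<and> finite I \<and> 0 \<notin> I"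

definition lamI :: "nat set \<Rightarrow> nat list" where
  "lamI I = (THE lam. is_partition lam \<and> part lam 1 = part lam 2 \<and> ribbon_corr (rim lam) I)"

definition muI :: "nat set \<Rightarrow> nat list" where
  "muI I = (THE mu. is_partition mu \<and> diagram mu \<subseteq> diagram (lamI I)
             \<and> rim (lamI I) = diagram (lamI I) - diagram mu)"

definition sI :: "nat set \<Rightarrow> nat" where
  "sI I = part (lamI I) 1 - 1"

definition wI :: "nat set \<Rightarrow> nat" where
  "wI I = card {j. 1 \<le> j \<and> j \<le> sI I + 1 \<and> conj_part (lamI I) j = 2}"

definition NN_coeff :: "nat set \<Rightarrow> nat \<Rightarrow> nat" where
  "NN_coeff I j = (\<Sum>D \<in> {D \<in> excited (lamI I) (muI I). card {c \<in> D. fst c = 1} = sI I - j}.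
                     \<Prod>c \<in> {c \<in> D. fst c \<noteq> 1}. hook (lamI I) c)"

end

(*
  For a ribbon, the excited diagrams are the complements of the lattice paths that climb from the
  lower-left cell (length lam, 1) to the upper-right cell (1, lam_1) inside the diagram of lam. Let
  G(i,k) be the sum over the paths ending at (i,k) of the product of the inverse hook lengths. A path
  enters row 1 at column s+1-j exactly when its complement has s-j cells in row 1, so C_j is G(2,s+1-j)
  times the product of all hook lengths below row 1. The recursion
    h(i,k) G(i,k) = G(i,k-1) + G(i+1,k)
  turns the claim into the comparison leg(i,k) G(i,k-1) < (arm(i,k)+1) G(i+1,k) when (i+1,k) is a cell.
  This follows by induction on k and on the leg length: the case (i,k-1) bounds leg(i,k) G(i,k-1) by
  G(i+1,k-1), and the case (i+1,k) bounds G(i+1,k-1) by (arm(i,k)+1) G(i+1,k).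
*)

theory Submission
  imports Defs
begin

section \<open>Diagrams, rims and hooks\<close>

lemma diagram_iff: "(i, j) \<in> diagram lam \<longleftrightarrow> 1 \<le> i \<and> 1 \<le> j \<and> j \<le> part lam i"
  unfolding diagram_def part_def by auto

lemma diagram_pos: "(i, j) \<in> diagram lam \<Longrightarrow> 1 \<le> i \<and> 1 \<le> j"
  by (simp add: diagram_iff)

lemma part_pos_iff:
  assumes "is_partition lam" "1 \<le> i"
  shows "0 < part lam i \<longleftrightarrow> i \<le> length lam"
proof -
  have "0 < lam ! (i - 1)" if "i \<le> length lam"
  proof -
    have "lam ! (i - 1) \<in> set lam" using assms(2) that by (intro nth_mem) simp
    then show ?thesis using assms(1) unfolding is_partition_def by (metis gr0I)
  qed
  then show ?thesis using assms unfolding part_def by auto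
qed

lemma part_antimono:
  assumes "is_partition lam" "1 \<le> i" "i \<le> i'"
  shows "part lam i' \<le> part lam i"
proof (cases "i = i' \<or> length lam < i'")
  case True
  then show ?thesis using assms by (auto simp: part_def)
next
  case False
  then show ?thesis using assms
    unfolding is_partition_def part_def by (auto simp: sorted_wrt_iff_nth_less)
qed

lemma diagram_downset:
  assumes "is_partition lam" "(i, j) \<in> diagram lam" "1 \<le> i'" "i' \<le> i" "1 \<le> j'" "j' \<le> j"
  shows "(i', j') \<in> diagram lam"
  using assms part_antimono[of lam i' i] by (simp add: diagram_iff)

lemma finite_diagram: "finite (diagram lam)"
proof (rule finite_subset)
  show "diagram lam \<subseteq> (\<Union>i\<in>{1..length lam}. {i} \<times> {1..lam ! (i - 1)})"
    unfolding diagram_def by auto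
qed simp

text \<open>A diagram is a down-set, so all three neighbours lie in it exactly when the diagonal one
  does.\<close>

lemma rim_iff:
  assumes "is_partition lam"
  shows "(i, j) \<in> rim lam \<longleftrightarrow> (i, j) \<in> diagram lam \<and> (i + 1, j + 1) \<notin> diagram lam"
proof -
  let ?N = "{(i, j + 1), (i + 1, j), (i + 1, j + 1)}"
  have "card (?N \<inter> diagram lam) < 3 \<longleftrightarrow> (i + 1, j + 1) \<notin> diagram lam" if ij: "(i, j) \<in> diagram lam"
  proof
    assume *: "card (?N \<inter> diagram lam) < 3"
    show "(i + 1, j + 1) \<notin> diagram lam"
    proof
      assume "(i + 1, j + 1) \<in> diagram lam"
      then have "?N \<inter> diagram lam = ?N"
        using diagram_downset[OF assms, of "i + 1" "j + 1"] diagram_pos[OF ij] by auto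
      then show False using * by simp
    qed
  next
    assume "(i + 1, j + 1) \<notin> diagram lam"
    then have "?N \<inter> diagram lam \<subset> ?N" by blast
    then have "card (?N \<inter> diagram lam) < card ?N" by (rule psubset_card_mono[rotated]) simp
    then show "card (?N \<inter> diagram lam) < 3" by simp
  qed
  then show ?thesis unfolding rim_def by blast
qed

lemma finite_downset_eq_atLeastAtMost:
  fixes A :: "nat set"
  assumes "finite A" "0 \<notin> A" "\<And>a b. a \<in> A \<Longrightarrow> 1 \<le> b \<Longrightarrow> b \<le> a \<Longrightarrow> b \<in> A"
  shows "A = {1..card A}"
proof (cases "A = {}")
  case False
  have "A = {1..Max A}"
  proof
    show "A \<subseteq> {1..Max A}" using assms(1,2) by (metis Max_ge One_nat_def Suc_leI atLeastAtMost_iff gr0I subsetI)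
    show "{1..Max A} \<subseteq> A" using assms(3)[OF Max_in[OF assms(1) False]] by auto
  qed
  then show ?thesis by (metis card_atLeastAtMost diff_Suc_1 One_nat_def)
qed simp

text \<open>Serves to construct the partitions behind \<open>lamI\<close> and \<open>muI\<close>,
  both of which arise as sets of cells. The row lengths become the parts, and the length of column 1
  the number of parts.\<close>

lemma partition_of_downset:
  assumes "finite S" "\<And>i j. (i, j) \<in> S \<Longrightarrow> 1 \<le> i \<and> 1 \<le> j"
    and down: "\<And>i j i' j'. (i, j) \<in> S \<Longrightarrow> 1 \<le> i' \<Longrightarrow> i' \<le> i \<Longrightarrow> 1 \<le> j' \<Longrightarrow> j' \<le> j \<Longrightarrow> (i', j') \<in> S"
  obtains lam where "is_partition lam" "diagram lam = S"
proof -
  define f where "f i = card {j. (i, j) \<in> S}" for i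
  define m where "m = card {i. (i, 1) \<in> S}"
  have fin: "finite {j. (i, j) \<in> S}" for i
    using assms(1) by (rule finite_subset[rotated, OF finite_imageI[of _ snd]]) force
  have fin': "finite {i. (i, j) \<in> S}" for j
    using assms(1) by (rule finite_subset[rotated, OF finite_imageI[of _ fst]]) force
  have row: "{j. (i, j) \<in> S} = {1..f i}" for i
    unfolding f_def
  proof (rule finite_downset_eq_atLeastAtMost[OF fin])
    show "0 \<notin> {j. (i, j) \<in> S}" using assms(2) by fastforce
    fix a b assume "a \<in> {j. (i, j) \<in> S}" "1 \<le> b" "b \<le> a"
    then show "b \<in> {j. (i, j) \<in> S}" using down[of i a i b] assms(2)[of i a] by auto
  qed
  have col: "{i. (i, 1) \<in> S} = {1..m}"
    unfolding m_def
  proof (rule finite_downset_eq_atLeastAtMost[OF fin'])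
    show "0 \<notin> {i. (i, 1) \<in> S}" using assms(2) by fastforce
    fix a b assume "a \<in> {i. (i, 1) \<in> S}" "1 \<le> b" "b \<le> a"
    then show "b \<in> {i. (i, 1) \<in> S}" using down[of a 1 b 1] by auto
  qed
  have row': "(i, j) \<in> S \<longleftrightarrow> 1 \<le> j \<and> j \<le> f i" for i j
    using row[of i] by (metis (mono_tags) atLeastAtMost_iff mem_Collect_eq)
  have col': "(i, 1) \<in> S \<longleftrightarrow> 1 \<le> i \<and> i \<le> m" for i
    using col by (metis (mono_tags) atLeastAtMost_iff mem_Collect_eq)
  let ?lam = "map f [1..<Suc m]"
  have anti: "f i' \<le> f i" if "1 \<le> i" "i \<le> i'" for i i'
  proof (cases "f i' = 0")
    case False
    then have "(i', f i') \<in> S" by (simp add: row')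
    then have "(i, f i') \<in> S" using down[of i' "f i'" i "f i'"] that False by simp
    then show ?thesis by (simp add: row')
  qed simp
  have pos: "0 < f i" if "1 \<le> i" "i \<le> m" for i
    using that col'[of i] row'[of i 1] by simp
  have "is_partition ?lam"
    unfolding is_partition_def
  proof
    show "sorted_wrt (\<ge>) ?lam" by (auto simp: sorted_wrt_iff_nth_less simp del: upt_Suc intro!: anti)
    show "0 \<notin> set ?lam" using pos by (auto simp del: upt_Suc) (metis Suc_leI less_Suc_eq_le less_irrefl)
  qed
  moreover have "diagram ?lam = S"
  proof (rule set_eqI, clarify)
    fix i j
    have "i \<le> m" if "(i, j) \<in> S"
      using that down[of i j i 1] assms(2)[of i j] col'[of i] by simp
    then show "(i, j) \<in> diagram ?lam \<longleftrightarrow> (i, j) \<in> S"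
      using row'[of i j] assms(2)[of i j]
      by (auto simp: diagram_def simp del: upt_Suc)
  qed
  ultimately show ?thesis using that by blast
qed

lemma partition_eqI:
  assumes "is_partition lam" "is_partition lam'" "diagram lam = diagram lam'"
  shows "lam = lam'"
proof -
  have part_le: "j \<le> part lam i \<longleftrightarrow> j \<le> part lam' i" if "1 \<le> i" for i j
  proof (cases "j = 0")
    case False
    then show ?thesis using that assms(3) diagram_iff[of i j lam] diagram_iff[of i j lam'] by simp
  qed simp
  have eq: "part lam i = part lam' i" if "1 \<le> i" for i
    using part_le[OF that] by (meson order.refl order_antisym)
  have "i \<le> length lam \<longleftrightarrow> i \<le> length lam'" if "1 \<le> i" for i
    using eq[OF that] part_pos_iff[OF assms(1) that] part_pos_iff[OF assms(2) that] by simp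
  then have len: "length lam = length lam'"
    by (metis One_nat_def Suc_leI le_antisym length_0_conv length_greater_0_conv nle_le)
  show ?thesis
  proof (rule nth_equalityI[OF len])
    fix i assume "i < length lam"
    then show "lam ! i = lam' ! i" using eq[of "Suc i"] len by (simp add: part_def)
  qed
qed

lemma diagram_column:
  assumes "is_partition lam" "1 \<le> j"
  shows "(i, j) \<in> diagram lam \<longleftrightarrow> 1 \<le> i \<and> i \<le> conj_part lam j"
proof -
  have "{i. (i, j) \<in> diagram lam} = {1..conj_part lam j}"
    unfolding conj_part_def
  proof (rule finite_downset_eq_atLeastAtMost)
    show "finite {i. (i, j) \<in> diagram lam}"
      using finite_diagram[of lam] by (rule finite_subset[rotated, OF finite_imageI[of _ fst]]) force
    show "0 \<notin> {i. (i, j) \<in> diagram lam}" using diagram_pos by fastforce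
  next
    fix a b assume "a \<in> {i. (i, j) \<in> diagram lam}" "1 \<le> b" "b \<le> a"
    then show "b \<in> {i. (i, j) \<in> diagram lam}" using diagram_downset[OF assms(1), of a j b j] assms(2) by auto
  qed
  then show ?thesis by (metis (mono_tags) atLeastAtMost_iff mem_Collect_eq)
qed

lemma hook_eq:
  assumes "is_partition lam" "(i, j) \<in> diagram lam"
  shows "hook lam (i, j) = (part lam i - j + 1) + (conj_part lam j - i)"
proof -
  have j: "1 \<le> j" "1 \<le> i" "j \<le> part lam i" using assms(2) by (auto simp: diagram_iff)
  have "{c' \<in> diagram lam. (fst c' = i \<and> snd c' \<ge> j) \<or> (snd c' = j \<and> fst c' \<ge> i)}
      = {i} \<times> {j..part lam i} \<union> {Suc i..conj_part lam j} \<times> {j}"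
  proof (rule set_eqI, clarify)
    fix a b
    show "(a, b) \<in> {c' \<in> diagram lam. (fst c' = i \<and> snd c' \<ge> j) \<or> (snd c' = j \<and> fst c' \<ge> i)}
      \<longleftrightarrow> (a, b) \<in> {i} \<times> {j..part lam i} \<union> {Suc i..conj_part lam j} \<times> {j}"
      using j diagram_iff[of i b lam] diagram_column[OF assms(1) j(1), of a] diagram_iff[of i j lam]
      by (cases "a = i"; cases "b = j") auto
  qed
  moreover have "card ({i} \<times> {j..part lam i} \<union> {Suc i..conj_part lam j} \<times> {j})
      = (part lam i - j + 1) + (conj_part lam j - i)"
    using j by (subst card_Un_disjoint) (auto simp: card_cartesian_product)
  ultimately show ?thesis unfolding hook_def by simp
qed

section \<open>The partition of a descent set\<close>

text \<open>\<open>ribbon_row\<close> and \<open>ribbon_col\<close> are the coordinates of cell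
  \<open>k\<close> of the ribbon: an \<open>i\<close> in \<open>I\<close> is a step up from cell
  \<open>i\<close>, any other \<open>i\<close> a step right. The row is counted back from the end of
  the ribbon in row 1, the column forward from its start in column 1.\<close>

definition ribbon_row :: "nat set \<Rightarrow> nat \<Rightarrow> nat" where
  "ribbon_row I k = 1 + card {i \<in> I. k \<le> i}"

definition ribbon_col :: "nat set \<Rightarrow> nat \<Rightarrow> nat" where
  "ribbon_col I k = 1 + card {i. 1 \<le> i \<and> i < k \<and> i \<notin> I}"

lemma ribbon_row_Suc:
  assumes "finite I"
  shows "ribbon_row I k = ribbon_row I (Suc k) + (if k \<in> I then 1 else 0)"
proof -
  have "{i \<in> I. k \<le> i} = (if k \<in> I then insert k {i \<in> I. Suc k \<le> i} else {i \<in> I. Suc k \<le> i})"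
    by (auto simp: Suc_le_eq order_le_less)
  then show ?thesis using assms unfolding ribbon_row_def by simp
qed

lemma ribbon_col_Suc:
  assumes "1 \<le> k"
  shows "ribbon_col I (Suc k) = ribbon_col I k + (if k \<in> I then 0 else 1)"
proof -
  have "{i. 1 \<le> i \<and> i < Suc k \<and> i \<notin> I} =
      (if k \<in> I then {i. 1 \<le> i \<and> i < k \<and> i \<notin> I} else insert k {i. 1 \<le> i \<and> i < k \<and> i \<notin> I})"
    using assms by (auto simp: less_Suc_eq)
  then show ?thesis unfolding ribbon_col_def by simp
qed

lemma ribbon_row_antimono:
  assumes "finite I" "k \<le> k'"
  shows "ribbon_row I k' \<le> ribbon_row I k"
  unfolding ribbon_row_def using assms by (auto intro!: card_mono)

lemma ribbon_col_mono: "k \<le> k' \<Longrightarrow> ribbon_col I k \<le> ribbon_col I k'"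
  unfolding ribbon_col_def by (auto intro!: card_mono)

text \<open>Each step, up or right, raises column minus row by one, so the diagonal of a ribbon cell
  determines its index. The additive form avoids truncated subtraction.\<close>

lemma ribbon_content:
  assumes "is_descent_set I" "1 \<le> k"
  shows "ribbon_col I k + card I + 1 = ribbon_row I k + k"
  using assms(2)
proof (induction k rule: dec_induct)
  case base
  have "{i \<in> I. 1 \<le> i} = I"
    using assms(1) by (auto simp: is_descent_set_def Suc_le_eq intro: gr0I)
  moreover have "{i. 1 \<le> i \<and> i < (1::nat) \<and> i \<notin> I} = {}" by auto
  ultimately show ?case unfolding ribbon_row_def ribbon_col_def by simp
next
  case (step k)
  then show ?case
    using ribbon_row_Suc[of I k] ribbon_col_Suc[of k I] assms(1)
    by (auto simp: is_descent_set_def split: if_splits)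
qed

text \<open>The condition \<open>part lam 1 = part lam 2\<close> makes the last step of the ribbon
  an upward one. Hence the ribbon has \<open>Suc (Max I)\<close> cells, and the last two share a
  column.\<close>

lemma ribbon_top:
  assumes "is_descent_set I"
  shows "ribbon_row I (Suc (Max I)) = 1" "ribbon_row I (Max I) = 2"
    "ribbon_col I (Suc (Max I)) = ribbon_col I (Max I)" "1 \<le> Max I"
proof -
  have I: "finite I" "I \<noteq> {}" "0 \<notin> I" using assms by (auto simp: is_descent_set_def)
  have Max: "Max I \<in> I" using I by simp
  show le: "1 \<le> Max I" using Max I(3) by (metis One_nat_def Suc_leI gr0I)
  have "{i \<in> I. Suc (Max I) \<le> i} = {}" using I by (auto simp: not_less_eq_eq[symmetric])
  then show "ribbon_row I (Suc (Max I)) = 1" unfolding ribbon_row_def by (metis add.right_neutral card.empty)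
  then show "ribbon_row I (Max I) = 2" using ribbon_row_Suc[OF I(1), of "Max I"] Max by simp
  show "ribbon_col I (Suc (Max I)) = ribbon_col I (Max I)" using ribbon_col_Suc[OF le, of I] Max by simp
qed

lemma ribbon_partition_exists:
  assumes "is_descent_set I"
  obtains lam where "is_partition lam" "part lam 1 = part lam 2" "ribbon_corr (rim lam) I"
proof -
  have I: "finite I" "I \<noteq> {}" "0 \<notin> I" using assms by (auto simp: is_descent_set_def)
  define n where "n = Suc (Max I)"
  note top = ribbon_top[OF assms, folded n_def]
  let ?r = "ribbon_row I" and ?c = "ribbon_col I"
  \<comment> \<open>\<open>S\<close> is the down-set generated by the ribbon cells.\<close>
  define S where "S = {(i, j). 1 \<le> i \<and> 1 \<le> j \<and> (\<exists>k\<in>{1..n}. i \<le> ?r k \<and> j \<le> ?c k)}"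
  have "finite S"
  proof (rule finite_subset)
    show "S \<subseteq> (\<Union>k\<in>{1..n}. {1..?r k} \<times> {1..?c k})" unfolding S_def by auto
  qed simp
  then obtain lam where lam: "is_partition lam" "diagram lam = S"
    by (rule partition_of_downset) (auto simp: S_def intro: le_trans)
  have n: "1 \<le> n" "1 \<le> n - 1" "n - 1 \<le> n" "n - 1 = Max I" using top by (auto simp: n_def)
  have le_c: "?c k \<le> ?c n" if "k \<le> n" for k using ribbon_col_mono[OF that] .
  \<comment> \<open>Cell \<open>n - 1\<close> lies in row 2 directly below cell \<open>n\<close>, so
    rows 1 and 2 both reach exactly column \<open>?c n\<close>.\<close>
  have row12: "(i, j) \<in> S \<longleftrightarrow> 1 \<le> j \<and> j \<le> ?c n" if "i \<in> {1, 2}" for i j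
  proof
    assume "(i, j) \<in> S"
    then show "1 \<le> j \<and> j \<le> ?c n" using le_c unfolding S_def by (fastforce intro: le_trans)
  next
    assume "1 \<le> j \<and> j \<le> ?c n"
    then show "(i, j) \<in> S" unfolding S_def using that n top
      by (auto intro!: bexI[of _ "n - 1"])
  qed
  have row: "j \<le> part lam i \<longleftrightarrow> j \<le> ?c n" if "i \<in> {1, 2}" for i j
    using that row12[OF that, of j] lam(2) diagram_iff[of i j lam] by (cases "j = 0") auto
  have "part lam 1 = part lam 2"
    using row[of 1] row[of 2] by (meson insertI1 insertI2 order.refl order_antisym)
  moreover
  have above: "k' < k" if "?r k < ?r k'" for k k'
    using ribbon_row_antimono[OF I(1), of k k'] that by (metis not_le)
  have right: "k < k'" if "?c k < ?c k'" for k k'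
    using ribbon_col_mono[of k' k I] that by (metis not_le)
  \<comment> \<open>Such a cell of \<open>S\<close> would require a ribbon cell \<open>k'\<close> in
    a lower row than cell \<open>k\<close>, so \<open>k' < k\<close>, and in a later column, so
    \<open>k < k'\<close>.\<close>
  have not_S: "(?r k + u, ?c k + u) \<notin> S" if "1 \<le> u" for k u
  proof
    assume "(?r k + u, ?c k + u) \<in> S"
    then obtain k' where "?r k + u \<le> ?r k'" "?c k + u \<le> ?c k'" unfolding S_def by auto
    then have "?r k < ?r k'" "?c k < ?c k'" using that by auto
    then show False using above right by (meson less_asym)
  qed
  have S_ribbon: "(?r k, ?c k) \<in> S" if "k \<in> {1..n}" for k
    using that unfolding S_def by (auto simp: ribbon_row_def ribbon_col_def)
  let ?p = "\<lambda>k. (?r k, ?c k)"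
  have "rim lam = ?p ` {1..n}"
  proof (rule set_eqI, clarify)
    fix i j
    show "(i, j) \<in> rim lam \<longleftrightarrow> (i, j) \<in> ?p ` {1..n}"
    proof
      assume "(i, j) \<in> ?p ` {1..n}"
      then show "(i, j) \<in> rim lam"
        using S_ribbon not_S[of 1] unfolding rim_iff[OF lam(1)] lam(2) by auto
    next
      assume "(i, j) \<in> rim lam"
      then have ij: "(i, j) \<in> S" "(i + 1, j + 1) \<notin> S" unfolding rim_iff[OF lam(1)] lam(2) by auto
      then obtain k0 where k0: "k0 \<in> {1..n}" "i \<le> ?r k0" "j \<le> ?c k0" "1 \<le> i" "1 \<le> j"
        unfolding S_def by auto
      have i_le: "i \<le> card I + 1"
        using k0(2) card_mono[OF I(1), of "{i \<in> I. k0 \<le> i}"] unfolding ribbon_row_def by fastforce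
      have j_le: "j \<le> ?c n" using k0 le_c[of k0] by simp
      \<comment> \<open>The index of the ribbon cell on the diagonal of \<open>(i, j)\<close>,
        solved from \<open>ribbon_content\<close>. If \<open>(i, j)\<close> lay above that cell,
        \<open>(i + 1, j + 1)\<close> would be in \<open>S\<close>; if below, \<open>not_S\<close>
        would exclude \<open>(i, j)\<close>.\<close>
      define k where "k = j + card I + 1 - i"
      have k: "k + i = j + card I + 1" using i_le unfolding k_def by simp
      have kn: "k \<in> {1..n}" using k i_le j_le k0 ribbon_content[OF assms n(1)] top(1) by auto
      have c: "?c k + i = ?r k + j" using ribbon_content[OF assms, of k] kn k by auto
      have "i = ?r k"
      proof (rule ccontr)
        assume "i \<noteq> ?r k"
        then consider "i < ?r k" | "?r k < i" by linarith
        then show False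
        proof cases
          case 1
          then have "(i + 1, j + 1) \<in> S" using c kn unfolding S_def by (auto intro!: bexI[of _ k])
          then show False using ij by simp
        next
          case 2
          then have "(i, j) = (?r k + (i - ?r k), ?c k + (i - ?r k))" using c by auto
          then show False using not_S[of "i - ?r k" k] ij(1) 2 by (metis One_nat_def Suc_leI zero_less_diff)
        qed
      qed
      then show "(i, j) \<in> ?p ` {1..n}" using c kn by auto
    qed
  qed
  moreover have "inj_on ?p {1..n}"
  proof (rule inj_onI)
    fix k k' assume "k \<in> {1..n}" "k' \<in> {1..n}" "?p k = ?p k'"
    then show "k = k'" using ribbon_content[OF assms, of k] ribbon_content[OF assms, of k'] by auto
  qed
  moreover have step: "?r k = ?r (k + 1) + (if k \<in> I then 1 else 0) \<and> ?c (k + 1) = ?c k + (if k \<in> I then 0 else 1)"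
    if "k \<in> {1..<n}" for k
    using that ribbon_row_Suc[OF I(1), of k] ribbon_col_Suc[of k I] by simp
  have "\<forall>k\<in>{1..<n}. ?p (k + 1) = (fst (?p k), snd (?p k) + 1)
                   \<or> (fst (?p k) = fst (?p (k + 1)) + 1 \<and> snd (?p (k + 1)) = snd (?p k))"
  proof
    fix k assume "k \<in> {1..<n}"
    from step[OF this] show "?p (k + 1) = (fst (?p k), snd (?p k) + 1)
                   \<or> (fst (?p k) = fst (?p (k + 1)) + 1 \<and> snd (?p (k + 1)) = snd (?p k))"
      by (cases "k \<in> I") auto
  qed
  moreover have "I = {k \<in> {1..<n}. fst (?p k) = fst (?p (k + 1)) + 1 \<and> snd (?p (k + 1)) = snd (?p k)}"
  proof -
    have "k \<in> {1..<n}" if "k \<in> I" for k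
    proof -
      have "k \<le> Max I" using I(1) that by simp
      moreover have "k \<noteq> 0" using that I(3) by metis
      ultimately show ?thesis by (simp add: n_def)
    qed
    moreover have "k \<in> I \<longleftrightarrow> ?r k = ?r (k + 1) + 1 \<and> ?c (k + 1) = ?c k" if "k \<in> {1..<n}" for k
      using step[OF that] by (cases "k \<in> I") auto
    ultimately show ?thesis
      by (intro set_eqI) (simp only: mem_Collect_eq fst_conv snd_conv, blast)
  qed
  ultimately have "ribbon_corr (rim lam) I" unfolding ribbon_corr_def by blast
  then show ?thesis using that lam(1) \<open>part lam 1 = part lam 2\<close> by blast
qed

text \<open>The enumeration of the rim is forced: it starts at \<open>(length lam, 1)\<close>, it
  ends with the step from \<open>(2, part lam 1)\<close> up to \<open>(1, part lam 1)\<close>, and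
  \<open>I\<close> prescribes every step. So the rim depends on \<open>I\<close> alone.\<close>

lemma rim_eq_ribbon:
  assumes "is_descent_set I" and lam: "is_partition lam" and eq: "part lam 1 = part lam 2"
    and "ribbon_corr (rim lam) I"
  shows "rim lam = (\<lambda>k. (ribbon_row I k, ribbon_col I k)) ` {1..Suc (Max I)}" and "2 \<le> length lam"
proof -
  have I: "finite I" "I \<noteq> {}" "0 \<notin> I" using assms by (auto simp: is_descent_set_def)
  obtain c n where cn: "inj_on c {1..n} \<and> rim lam = c ` {1..n} \<and>
      (\<forall>k\<in>{1..<n}. c (k + 1) = (fst (c k), snd (c k) + 1)
                   \<or> (fst (c k) = fst (c (k + 1)) + 1 \<and> snd (c (k + 1)) = snd (c k))) \<and>
      I = {k \<in> {1..<n}. fst (c k) = fst (c (k + 1)) + 1 \<and> snd (c (k + 1)) = snd (c k)}"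
    using assms(4) unfolding ribbon_corr_def by (elim exE)
  then have inj: "inj_on c {1..n}" and R: "rim lam = c ` {1..n}"
    and Ieq: "I = {k \<in> {1..<n}. fst (c k) = fst (c (k + 1)) + 1 \<and> snd (c (k + 1)) = snd (c k)}"
    by - ((elim conjE)?, assumption)+
  have st: "c (k + 1) = (fst (c k), snd (c k) + 1)
       \<or> (fst (c k) = fst (c (k + 1)) + 1 \<and> snd (c (k + 1)) = snd (c k))" if "k \<in> {1..<n}" for k
    using cn that by (elim conjE) (drule (1) bspec)
  have I_iff: "k \<in> I \<longleftrightarrow> fst (c k) = fst (c (k + 1)) + 1 \<and> snd (c (k + 1)) = snd (c k)"
    if "k \<in> {1..<n}" for k
    using that by (subst Ieq) simp
  have I_sub: "I \<subseteq> {1..<n}" by (subst Ieq) (rule Collect_restrict)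
  have rimD: "c k \<in> diagram lam" if "k \<in> {1..n}" for k
    using that R rim_iff[OF lam] by (metis imageI surj_pair)
  have "n \<ge> 2" using I(2) I_sub by fastforce
  then have "c 1 \<in> diagram lam" using rimD[of 1] by simp
  then have one: "1 \<le> part lam 1"
    using diagram_downset[OF lam, of "fst (c 1)" "snd (c 1)" 1 1] diagram_pos[of "fst (c 1)" "snd (c 1)" lam]
    by (simp add: diagram_iff)
  let ?m = "part lam 1" and ?l = "length lam"
  show len: "2 \<le> length lam" using one eq part_pos_iff[OF lam, of 2] by simp
  have "(1, ?m) \<in> rim lam" "(2, ?m) \<in> rim lam" "(?l, 1) \<in> rim lam"
    using one eq len part_antimono[OF lam, of 2 3] part_pos_iff[OF lam, of ?l] part_pos_iff[OF lam, of "Suc ?l"]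
    by (auto simp: rim_iff[OF lam] diagram_iff numeral_2_eq_2 numeral_3_eq_3)
  then obtain k1 k2 k3 where k: "k1 \<in> {1..n}" "c k1 = (1, ?m)" "k2 \<in> {1..n}" "c k2 = (2, ?m)"
      "k3 \<in> {1..n}" "c k3 = (?l, 1)"
    unfolding R by (elim imageE) metis
  \<comment> \<open>A successor of \<open>(1, ?m)\<close> would lie in row 0 or in column
    \<open>?m + 1\<close>.\<close>
  have k1: "k1 = n"
  proof (rule ccontr)
    assume "k1 \<noteq> n"
    then have "k1 \<in> {1..<n}" "k1 + 1 \<in> {1..n}" using k(1) by auto
    then show False
      using st[of k1] rimD[of "k1 + 1"] k(2) diagram_iff[of "fst (c (k1 + 1))" "snd (c (k1 + 1))" lam] by auto
  qed
  have "k2 \<noteq> n" using k k1 by auto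
  then have k2n: "k2 \<in> {1..<n}" "k2 + 1 \<in> {1..n}" using k(3) by auto
  \<comment> \<open>Row 2 also ends in column \<open>?m\<close>, so the step after
    \<open>(2, ?m)\<close> cannot go right.\<close>
  then have step2: "fst (c k2) = fst (c (k2 + 1)) + 1 \<and> snd (c (k2 + 1)) = snd (c k2)"
    using st[of k2] rimD[of "k2 + 1"] k(4) eq diagram_iff[of "fst (c (k2 + 1))" "snd (c (k2 + 1))" lam] by auto
  moreover have "fst (c k2) = 2" "snd (c k2) = ?m" using k(4) by simp_all
  ultimately have "fst (c (k2 + 1)) = 1" "snd (c (k2 + 1)) = ?m" by linarith+
  then have "c (k2 + 1) = (1, ?m)" by (metis prod.collapse)
  then have "c (k2 + 1) = c n" using k(2) k1 by simp
  then have k2: "k2 + 1 = n" using inj_onD[OF inj _ k2n(2), of n] \<open>n \<ge> 2\<close> by simp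
  have "k2 \<in> I" using step2 I_iff[OF k2n(1)] by blast
  then have Max: "n = Suc (Max I)"
    using I(1) k2 I_sub by (subst Max_eqI[of I k2]) fastforce+
  \<comment> \<open>A predecessor of \<open>(?l, 1)\<close> would lie in column 0 or in row
    \<open>?l + 1\<close>.\<close>
  have k3: "k3 = 1"
  proof (rule ccontr)
    assume "k3 \<noteq> 1"
    then have k3': "k3 - 1 \<in> {1..<n}" "k3 - 1 \<in> {1..n}" "k3 - 1 + 1 = k3" using k(5) by auto
    then show False
      using st[of "k3 - 1"] rimD[of "k3 - 1"] k(6) len part_pos_iff[OF lam, of "Suc ?l"]
        diagram_iff[of "fst (c (k3 - 1))" "snd (c (k3 - 1))" lam] by auto
  qed
  note top = ribbon_top[OF assms(1), folded Max]
  have stepI: "fst (c k) = fst (c (Suc k)) + (if k \<in> I then 1 else 0) \<and>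
      snd (c (Suc k)) = snd (c k) + (if k \<in> I then 0 else 1)" if "k \<in> {1..<n}" for k
    using st[OF that] I_iff[OF that] by (cases "k \<in> I") auto
  \<comment> \<open>The row is known at the last cell and the column at the first, so the two
    inductions run in opposite directions.\<close>
  have row: "fst (c k) = ribbon_row I k" if "k \<in> {1..n}" for k
  proof -
    have "k \<le> n" using that by simp
    then show ?thesis using that
    proof (induction k rule: inc_induct)
      case base
      then show ?case using k k1 top by simp
    next
      case (step k)
      then show ?case using stepI[of k] ribbon_row_Suc[OF I(1), of k] by simp
    qed
  qed
  have col: "snd (c k) = ribbon_col I k" if "k \<in> {1..n}" for k
  proof -
    have "1 \<le> k" using that by simp
    then show ?thesis using that
    proof (induction k rule: dec_induct)
      case base
      have "{i. 1 \<le> i \<and> i < (1::nat) \<and> i \<notin> I} = {}" by auto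
      then show ?case using k k3 unfolding ribbon_col_def by simp
    next
      case (step k)
      then show ?case using stepI[of k] ribbon_col_Suc[of k I] by simp
    qed
  qed
  show "rim lam = (\<lambda>k. (ribbon_row I k, ribbon_col I k)) ` {1..Suc (Max I)}"
    unfolding R Max[symmetric] using row col by (intro image_cong) (auto simp: prod_eq_iff)
qed

text \<open>Going down the diagonal of a cell, the last cell still in the diagram belongs to the
  rim.\<close>

lemma diagram_eq_of_rim:
  assumes "is_partition lam"
  shows "diagram lam = {(i, j). 1 \<le> i \<and> 1 \<le> j \<and> (\<exists>d. (i + d, j + d) \<in> rim lam)}"
proof (rule set_eqI, clarify, rule iffI)
  fix i j assume ij: "(i, j) \<in> diagram lam"
  let ?D = "{d. (i + d, j + d) \<in> diagram lam}"
  have fin: "finite ?D"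
    by (rule finite_subset[OF _ finite_imageI[OF finite_diagram[of lam], of "\<lambda>c. fst c - i"]]) force
  have "Max ?D \<in> ?D" using ij by (intro Max_in[OF fin]) (auto intro: exI[of _ 0])
  moreover have "Max ?D + 1 \<notin> ?D" using Max_ge[OF fin, of "Max ?D + 1"] by auto
  ultimately have "(i + Max ?D, j + Max ?D) \<in> rim lam" by (auto simp: rim_iff[OF assms])
  then show "(i, j) \<in> {(i, j). 1 \<le> i \<and> 1 \<le> j \<and> (\<exists>d. (i + d, j + d) \<in> rim lam)}"
    using diagram_pos[OF ij] by blast
next
  fix i j assume "(i, j) \<in> {(i, j). 1 \<le> i \<and> 1 \<le> j \<and> (\<exists>d. (i + d, j + d) \<in> rim lam)}"
  then obtain d where "1 \<le> i" "1 \<le> j" "(i + d, j + d) \<in> rim lam" by blast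
  then show "(i, j) \<in> diagram lam"
    using diagram_downset[OF assms, of "i + d" "j + d" i j] by (auto simp: rim_iff[OF assms])
qed

text \<open>The definite description in \<open>lamI\<close> denotes: the set \<open>I\<close> fixes
  the rim, and the rim fixes the diagram.\<close>

lemma lamI_props:
  assumes "is_descent_set I"
  shows "is_partition (lamI I)" "part (lamI I) 1 = part (lamI I) 2" "2 \<le> length (lamI I)"
proof -
  let ?P = "\<lambda>lam. is_partition lam \<and> part lam 1 = part lam 2 \<and> ribbon_corr (rim lam) I"
  obtain lam where "?P lam" using ribbon_partition_exists[OF assms] by blast
  moreover have "lam = lam'" if "?P lam" "?P lam'" for lam lam'
  proof (rule partition_eqI)
    have "rim lam = rim lam'" using that rim_eq_ribbon(1)[OF assms, of lam] rim_eq_ribbon(1)[OF assms, of lam'] by metis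
    then show "diagram lam = diagram lam'"
      using that diagram_eq_of_rim by auto
  qed (use that in auto)
  ultimately have "\<exists>!lam. ?P lam" by blast
  then have P: "?P (lamI I)" unfolding lamI_def by (rule theI')
  then show "is_partition (lamI I)" "part (lamI I) 1 = part (lamI I) 2" by auto
  show "2 \<le> length (lamI I)" using P rim_eq_ribbon(2)[OF assms] by blast
qed

text \<open>Removing the rim leaves the cells whose diagonal successor is in the diagram. They form
  a down-set, hence the diagram of a unique partition.\<close>

lemma diagram_muI:
  assumes "is_descent_set I"
  shows "diagram (muI I) = {(i, j). 1 \<le> i \<and> 1 \<le> j \<and> (i + 1, j + 1) \<in> diagram (lamI I)}"
proof -
  let ?lam = "lamI I"
  let ?S = "{(i, j). 1 \<le> i \<and> 1 \<le> j \<and> (i + 1, j + 1) \<in> diagram ?lam}"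
  let ?Q = "\<lambda>mu. is_partition mu \<and> diagram mu \<subseteq> diagram ?lam \<and> rim ?lam = diagram ?lam - diagram mu"
  note lam = lamI_props(1)[OF assms]
  have sub: "?S \<subseteq> diagram ?lam"
    using diagram_downset[OF lam] by fastforce
  have rim: "rim ?lam = diagram ?lam - ?S"
    using diagram_pos[of _ _ ?lam] by (auto simp: rim_iff[OF lam])
  obtain mu where mu: "is_partition mu" "diagram mu = ?S"
  proof (rule partition_of_downset)
    show "finite ?S" using sub finite_diagram finite_subset by blast
    show "(i', j') \<in> ?S" if "(i, j) \<in> ?S" "1 \<le> i'" "i' \<le> i" "1 \<le> j'" "j' \<le> j" for i j i' j'
      using that diagram_downset[OF lam, of "i + 1" "j + 1" "i' + 1" "j' + 1"] by auto
  qed auto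
  have S: "diagram mu' = ?S" if "?Q mu'" for mu'
    using that sub rim by blast
  have "\<exists>!mu. ?Q mu"
  proof
    show "?Q mu" using mu sub rim by simp
    show "mu' = mu" if "?Q mu'" for mu' using that partition_eqI[of mu' mu] S[of mu'] mu by simp
  qed
  then have "?Q (muI I)" unfolding muI_def by (rule theI')
  then show ?thesis by (rule S)
qed

section \<open>Excited diagrams as complements of lattice paths\<close>

text \<open>
  A path from the lower-left cell to the cell \<open>(i, k)\<close> is encoded by the rightmost column \<open>e r\<close> that it
  visits in each row \<open>r \<ge> i\<close>; in row \<open>r\<close> it occupies the columns from \<open>e (r + 1)\<close> to \<open>e r\<close>. The value 1 below
  the diagram makes the bottom row start in column 1, and 0 above row \<open>i\<close> makes the encoding unique.
\<close>

definition path_fun :: "nat list \<Rightarrow> nat \<Rightarrow> nat \<Rightarrow> (nat \<Rightarrow> nat) set" where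
  "path_fun lam i k = {e. (\<forall>r<i. e r = 0) \<and> e i = k \<and> (\<forall>r>length lam. e r = 1) \<and>
     (\<forall>r\<in>{i..length lam}. e (r + 1) \<le> e r \<and> e r \<le> part lam r)}"

definition path_cells :: "nat list \<Rightarrow> nat \<Rightarrow> (nat \<Rightarrow> nat) \<Rightarrow> (nat \<times> nat) set" where
  "path_cells lam i e = {(r, c). i \<le> r \<and> r \<le> length lam \<and> e (r + 1) \<le> c \<and> c \<le> e r}"

lemma path_funD:
  assumes "e \<in> path_fun lam i k"
  shows "r < i \<Longrightarrow> e r = 0" "e i = k" "length lam < r \<Longrightarrow> e r = 1"
    "i \<le> r \<Longrightarrow> r \<le> length lam \<Longrightarrow> e (Suc r) \<le> e r"
    "i \<le> r \<Longrightarrow> r \<le> length lam \<Longrightarrow> e r \<le> part lam r"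
  using assms unfolding path_fun_def by auto

lemma path_fun_antimono:
  assumes "e \<in> path_fun lam i k" "i \<le> r" "r \<le> r'"
  shows "e r' \<le> e r"
  using assms(3)
proof (induction r' rule: dec_induct)
  case (step r')
  have "e (Suc r') \<le> e r'"
    using path_funD(3,4)[OF assms(1)] assms(2) step(1) by (cases "r' \<le> length lam") auto
  then show ?case using step by simp
qed simp

lemma path_fun_pos:
  assumes "e \<in> path_fun lam i k" "i \<le> r"
  shows "1 \<le> e r"
proof (cases "r \<le> length lam")
  case True
  then show ?thesis using path_fun_antimono[OF assms, of "Suc (length lam)"] path_funD(3)[OF assms(1), of "Suc (length lam)"] by simp
qed (use path_funD(3)[OF assms(1), of r] in simp)

lemma path_cells_subset_diagram:
  assumes "1 \<le> i" "e \<in> path_fun lam i k"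
  shows "path_cells lam i e \<subseteq> diagram lam"
proof (clarify)
  fix r c assume "(r, c) \<in> path_cells lam i e"
  then have "i \<le> r" "r \<le> length lam" "e (r + 1) \<le> c" "c \<le> e r" unfolding path_cells_def by auto
  then show "(r, c) \<in> diagram lam"
    using path_fun_pos[OF assms(2), of "r + 1"] path_funD(5)[OF assms(2), of r] assms(1)
    by (simp add: diagram_iff)
qed

text \<open>The hypotheses say that the path turns through \<open>(i + 1, j)\<close>,
  \<open>(i + 1, j + 1)\<close>, \<open>(i, j + 1)\<close>; lowering \<open>e (i + 1)\<close>
  reroutes it through \<open>(i, j)\<close>. On complements this is one excitation.\<close>

lemma path_cells_flip:
  assumes "1 \<le> i" "i + 1 \<le> length lam" "e (i + 1) = j + 1" "e (i + 2) \<le> j" "j + 1 \<le> e i"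
  shows "path_cells lam 1 (e(i + 1 := j)) = insert (i, j) (path_cells lam 1 e - {(i + 1, j + 1)})"
proof (rule set_eqI, clarify)
  fix r c
  consider "r = i" | "r = i + 1" | "r \<noteq> i \<and> r \<noteq> i + 1" by blast
  then show "(r, c) \<in> path_cells lam 1 (e(i + 1 := j)) \<longleftrightarrow>
      (r, c) \<in> insert (i, j) (path_cells lam 1 e - {(i + 1, j + 1)})"
    by cases (use assms in \<open>auto simp: path_cells_def\<close>)
qed

lemma path_fun_flip:
  assumes "e \<in> path_fun lam 1 m" "1 \<le> i" "i + 1 \<le> length lam"
    "e (i + 2) \<le> j" "j \<le> e i" "j \<le> part lam (i + 1)"
  shows "e(i + 1 := j) \<in> path_fun lam 1 m"
  using assms unfolding path_fun_def by auto

text \<open>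
  The excited diagrams are the complements of the lattice paths, because exciting a cell pushes one
  corner of the path up and to the left, that is, lowers one value of \<^term>\<open>e\<close> by one. Conversely, in the
  topmost row where a path is not maximal its value can be raised by one.
\<close>

lemma excited_eq_path_complements:
  assumes lam: "is_partition lam" and len: "lam \<noteq> []"
    and mu: "diagram mu = {(i, j). 1 \<le> i \<and> 1 \<le> j \<and> (i + 1, j + 1) \<in> diagram lam}"
  shows "excited lam mu = (\<lambda>e. diagram lam - path_cells lam 1 e) ` path_fun lam 1 (part lam 1)"
proof
  let ?l = "length lam" and ?m = "part lam 1"
  \<comment> \<open>The maximal path, which follows the rim: every row is used up to its last
    cell.\<close>
  define e0 where "e0 r = (if r = 0 then 0 else if r \<le> ?l then part lam r else 1)" for r
  have "e0 (r + 1) \<le> e0 r" if "1 \<le> r" "r \<le> ?l" for r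
    using that part_antimono[OF lam, of r "r + 1"] part_pos_iff[OF lam, of r] unfolding e0_def by auto
  then have e0: "e0 \<in> path_fun lam 1 ?m"
    using len unfolding path_fun_def by (auto simp: e0_def Suc_le_eq)
  have mu_e0: "diagram mu = diagram lam - path_cells lam 1 e0"
  proof (rule set_eqI, clarify)
    fix r c
    have "(r, c) \<in> diagram mu \<longleftrightarrow> 1 \<le> r \<and> 1 \<le> c \<and> c + 1 \<le> part lam (r + 1)"
      by (auto simp: mu diagram_iff)
    also have "\<dots> \<longleftrightarrow> (r, c) \<in> diagram lam - path_cells lam 1 e0"
      using part_antimono[OF lam, of r "r + 1"] part_pos_iff[OF lam, of r] part_pos_iff[OF lam, of "r + 1"]
      by (auto simp: path_cells_def diagram_iff e0_def)
    finally show "(r, c) \<in> diagram mu \<longleftrightarrow> (r, c) \<in> diagram lam - path_cells lam 1 e0" .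
  qed
  show "excited lam mu \<subseteq> (\<lambda>e. diagram lam - path_cells lam 1 e) ` path_fun lam 1 ?m"
  proof
    fix D assume "D \<in> excited lam mu"
    then show "D \<in> (\<lambda>e. diagram lam - path_cells lam 1 e) ` path_fun lam 1 ?m"
    proof induction
      case base
      show ?case using e0 mu_e0 by blast
    next
      case (step D i j)
      then obtain e where e: "e \<in> path_fun lam 1 ?m" "D = diagram lam - path_cells lam 1 e" by blast
      have ij: "(i, j) \<in> diagram lam" "(i, j) \<notin> path_cells lam 1 e" using step e by auto
      then have pos: "1 \<le> i" "1 \<le> j" using diagram_pos by auto
      have "(i, j + 1) \<in> diagram lam" "(i + 1, j) \<in> diagram lam"
        using diagram_downset[OF lam step.hyps(3)] pos by auto
      then have cells: "(i, j + 1) \<in> path_cells lam 1 e" "(i + 1, j) \<in> path_cells lam 1 e"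
          "(i + 1, j + 1) \<in> path_cells lam 1 e"
        using step e by auto
      \<comment> \<open>As \<open>(i, j)\<close> is off the path and \<open>(i, j + 1)\<close> on
        it, row \<open>i\<close> of the path starts in column \<open>j + 1\<close>; the other two
        cells then make \<open>(i + 1, j + 1)\<close> a corner.\<close>
      then have *: "e (i + 1) = j + 1" "e (i + 2) \<le> j" "j + 1 \<le> e i" "i + 1 \<le> ?l"
        using ij(2) pos by (auto simp: path_cells_def)
      have "e(i + 1 := j) \<in> path_fun lam 1 ?m"
        using path_fun_flip[OF e(1) pos(1) *(4,2)] * path_funD(5)[OF e(1), of "i + 1"] by simp
      moreover have "insert (i + 1, j + 1) (D - {(i, j)}) = diagram lam - path_cells lam 1 (e(i + 1 := j))"
        using path_cells_flip[OF pos(1) *(4,1,2,3)] step.hyps(3) e(2) by auto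
      ultimately show ?case by blast
    qed
  qed
  show "(\<lambda>e. diagram lam - path_cells lam 1 e) ` path_fun lam 1 ?m \<subseteq> excited lam mu"
  proof clarify
    fix e assume "e \<in> path_fun lam 1 ?m"
    then show "diagram lam - path_cells lam 1 e \<in> excited lam mu"
    \<comment> \<open>The measure is the total distance of \<open>e\<close> from the maximal path
      \<open>e0\<close>.\<close>
    proof (induction "\<Sum>r\<in>{1..?l}. part lam r - e r" arbitrary: e rule: less_induct)
      case less
      note e = less.prems
      show ?case
      proof (cases "\<exists>r. 1 \<le> r \<and> r \<le> ?l \<and> e r < part lam r")
        case False
        have "e r = e0 r" for r
        proof -
          consider "r = 0" | "length lam < r" | "1 \<le> r" "r \<le> length lam" by linarith
          then show ?thesis
          proof cases
            case 3
            then have "\<not> e r < part lam r" using False by blast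
            then show ?thesis using 3 path_funD(5)[OF e, of r] by (simp add: e0_def)
          qed (use path_funD(1)[OF e, of r] path_funD(3)[OF e, of r] in \<open>auto simp: e0_def\<close>)
        qed
        then have "e = e0" by blast
        then show ?thesis using excited.base[of mu lam] mu_e0 by simp
      next
        case True
        \<comment> \<open>Every path is maximal in row 1, so the topmost deficient row
          \<open>r\<close> has a full row above it; this leaves room to raise \<open>e r\<close> by
          one.\<close>
        define r where "r = (LEAST r. 1 \<le> r \<and> r \<le> ?l \<and> e r < part lam r)"
        have r: "1 \<le> r" "r \<le> ?l" "e r < part lam r"
          using LeastI_ex[OF True] unfolding r_def by auto
        have "r \<noteq> 1" using r path_funD(2)[OF e] by auto
        then obtain i where i: "r = i + 1" "1 \<le> i" using r(1) by (intro that[of "r - 1"]) auto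
        have "\<not> e i < part lam i"
          using not_less_Least[of i "\<lambda>r. 1 \<le> r \<and> r \<le> ?l \<and> e r < part lam r"] i r(2) unfolding r_def by auto
        then have ei: "e i = part lam i" using path_funD(5)[OF e, of i] i r(2) by simp
        let ?j = "e r"
        let ?e = "e(i + 1 := ?j + 1)"
        have le: "?j + 1 \<le> e i" using ei r(3) part_antimono[OF lam i(2), of r] i by simp
        have le2: "e (i + 2) \<le> ?j" using path_funD(4)[OF e r(1,2)] i by simp
        have e': "?e \<in> path_fun lam 1 ?m"
          using path_fun_flip[OF e i(2), of "?j + 1"] le le2 r i by simp
        have "(\<Sum>r\<in>{1..?l}. part lam r - ?e r) < (\<Sum>r\<in>{1..?l}. part lam r - e r)"
          using r i by (intro sum_strict_mono_ex1) (auto intro!: bexI[of _ r])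
        from less.hyps[OF this e'] have exc: "diagram lam - path_cells lam 1 ?e \<in> excited lam mu" .
        have j1: "1 \<le> ?j" using path_fun_pos[OF e r(1)] .
        \<comment> \<open>Exciting \<open>(i, ?j)\<close> in the complement of the raised path gives
          back the complement of \<open>e\<close>.\<close>
        have "insert (i + 1, ?j + 1) (diagram lam - path_cells lam 1 ?e - {(i, ?j)}) \<in> excited lam mu"
        proof (rule excited.step[OF exc])
          show "(i + 1, ?j + 1) \<in> diagram lam" using r i by (simp add: diagram_iff)
          show "(i, ?j) \<in> diagram lam - path_cells lam 1 ?e"
            using j1 le ei i by (auto simp: diagram_iff path_cells_def)
          show "(i, ?j + 1) \<notin> diagram lam - path_cells lam 1 ?e"
            "(i + 1, ?j) \<notin> diagram lam - path_cells lam 1 ?e"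
            "(i + 1, ?j + 1) \<notin> diagram lam - path_cells lam 1 ?e"
            using le le2 i r by (auto simp: path_cells_def)
        qed
        moreover have "path_cells lam 1 (?e(i + 1 := ?j)) = insert (i, ?j) (path_cells lam 1 ?e - {(i + 1, ?j + 1)})"
          using le le2 i r by (intro path_cells_flip) auto
        moreover have "?e(i + 1 := ?j) = e" using i by auto
        moreover have "insert x (diagram lam - P - {y}) = diagram lam - insert y (P - {x})"
          if "x \<in> diagram lam" "x \<noteq> y" for x y P using that by blast
        moreover have "(i + 1, ?j + 1) \<in> diagram lam" "(i + 1, ?j + 1) \<noteq> (i, ?j)"
          using r i by (simp_all add: diagram_iff)
        ultimately show ?thesis by metis
      qed
    qed
  qed
qed

lemma path_cells_inj:
  assumes "1 \<le> i" "e \<in> path_fun lam i k" "e' \<in> path_fun lam i k" "path_cells lam i e = path_cells lam i e'"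
  shows "e = e'"
proof
  fix r
  have le: "f r \<le> g r" if "f \<in> path_fun lam i k" "path_cells lam i f = path_cells lam i g" "i \<le> r" "r \<le> length lam" for f g
  proof -
    have "(r, f r) \<in> path_cells lam i f"
      using that(3,4) path_funD(4)[OF that(1), of r] by (simp add: path_cells_def)
    then have "(r, f r) \<in> path_cells lam i g" by (simp only: that(2))
    then show ?thesis by (simp add: path_cells_def)
  qed
  consider "r < i" | "length lam < r" | "i \<le> r" "r \<le> length lam" by linarith
  then show "e r = e' r"
  proof cases
    case 3
    then show ?thesis using le[of e e'] le[of e' e] assms by (simp add: order_antisym)
  qed (use path_funD[OF assms(2)] path_funD[OF assms(3)] in auto)
qed

section \<open>Sums over lattice paths\<close>

text \<open>The sum G(i,k). Inverse hooks occur because the product over the complement of a path is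
  the full product divided by the product over the path.\<close>

definition path_sum :: "nat list \<Rightarrow> nat \<Rightarrow> nat \<Rightarrow> real" where
  "path_sum lam i k = (\<Sum>e\<in>path_fun lam i k. \<Prod>c\<in>path_cells lam i e. 1 / real (hook lam c))"

lemma hook_pos:
  assumes "is_partition lam" "c \<in> diagram lam"
  shows "0 < hook lam c"
  using assms hook_eq[of lam "fst c" "snd c"] by simp

lemma finite_path_cells:
  assumes "1 \<le> i" "e \<in> path_fun lam i k"
  shows "finite (path_cells lam i e)"
  using path_cells_subset_diagram[OF assms] finite_diagram finite_subset by blast

lemma finite_path_fun:
  assumes "1 \<le> i"
  shows "finite (path_fun lam i k)"
proof (rule inj_on_finite)
  show "inj_on (path_cells lam i) (path_fun lam i k)"
    using path_cells_inj[OF assms] by (auto intro: inj_onI)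
  show "path_cells lam i ` path_fun lam i k \<subseteq> Pow (diagram lam)"
    using path_cells_subset_diagram[OF assms] by auto
qed (simp add: finite_diagram)

lemma path_weight_pos:
  assumes "is_partition lam" "1 \<le> i" "e \<in> path_fun lam i k"
  shows "0 < (\<Prod>c\<in>path_cells lam i e. 1 / real (hook lam c))"
  using path_cells_subset_diagram[OF assms(2,3)] hook_pos[OF assms(1)] by (intro prod_pos) auto

lemma path_sum_nonneg:
  assumes "is_partition lam" "1 \<le> i"
  shows "0 \<le> path_sum lam i k"
  unfolding path_sum_def using path_weight_pos[OF assms] by (intro sum_nonneg) (auto intro: less_imp_le)

lemma path_sum_0: "path_sum lam i 0 = 0"
proof -
  have "path_fun lam i 0 = {}"
    using path_fun_pos[of _ lam i 0 i] path_funD(2)[of _ lam i 0] by force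
  then show ?thesis by (simp add: path_sum_def)
qed

text \<open>The bound \<open>2 \<le> k\<close> matters just below the diagram: in row
  \<open>length lam + 1\<close>, column 1 carries the empty path, of weight 1.\<close>

lemma path_sum_outside:
  assumes "2 \<le> k" "part lam i < k"
  shows "path_sum lam i k = 0"
proof -
  have "e \<notin> path_fun lam i k" for e
  proof
    assume e: "e \<in> path_fun lam i k"
    show False using path_funD(2)[OF e] path_funD(3)[OF e, of i] path_funD(5)[OF e, of i] assms
      by (cases "i \<le> length lam") auto
  qed
  then show ?thesis unfolding path_sum_def by (metis ex_in_conv sum.empty)
qed

lemma path_sum_first_column_pos:
  assumes "is_partition lam" "1 \<le> i" "i \<le> length lam + 1"
  shows "0 < path_sum lam i 1"
  unfolding path_sum_def
proof (rule sum_pos[OF finite_path_fun[OF assms(2)]])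
  \<comment> \<open>The path straight up column 1.\<close>
  have "(\<lambda>r. if r < i then 0 else 1) \<in> path_fun lam i 1"
    using assms part_pos_iff[OF assms(1)] by (auto simp: path_fun_def Suc_le_eq)
  then show "path_fun lam i 1 \<noteq> {}" by blast
qed (rule path_weight_pos[OF assms(1,2)])

text \<open>The last step into \<open>(i, k)\<close> comes from below if
  \<open>e (i + 1) = k\<close>, and from the left if \<open>e (i + 1) < k\<close>.\<close>

lemma path_fun_rec:
  assumes "i \<le> length lam" "1 \<le> k" "k \<le> part lam i"
  shows "path_fun lam i k = (\<lambda>e. e(i := k)) ` path_fun lam i (k - 1) \<union> (\<lambda>e. e(i := k)) ` path_fun lam (i + 1) k"
proof (intro equalityI subsetI)
  fix e assume e: "e \<in> path_fun lam i k"
  have le: "e (i + 1) \<le> k" using path_funD(2)[OF e] path_funD(4)[OF e, of i] assms(1) by simp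
  have e_eq: "e = (e(i := x))(i := k)" for x using path_funD(2)[OF e] by auto
  show "e \<in> (\<lambda>e. e(i := k)) ` path_fun lam i (k - 1) \<union> (\<lambda>e. e(i := k)) ` path_fun lam (i + 1) k"
  proof (cases "e (i + 1) = k")
    case True
    then have "e(i := 0) \<in> path_fun lam (i + 1) k"
      using e assms unfolding path_fun_def by (auto simp: less_Suc_eq)
    then show ?thesis using e_eq[of 0] by blast
  next
    case False
    then have "e(i := k - 1) \<in> path_fun lam i (k - 1)"
      using e assms le unfolding path_fun_def by auto
    then show ?thesis using e_eq[of "k - 1"] by blast
  qed
next
  fix e assume "e \<in> (\<lambda>e. e(i := k)) ` path_fun lam i (k - 1) \<union> (\<lambda>e. e(i := k)) ` path_fun lam (i + 1) k"
  then consider f where "e = f(i := k)" "f \<in> path_fun lam i (k - 1)"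
    | f where "e = f(i := k)" "f \<in> path_fun lam (i + 1) k" by blast
  then show "e \<in> path_fun lam i k"
  proof cases
    case 1
    then have "f (i + 1) \<le> k - 1" using path_funD(2,4)[OF 1(2)] assms(1) by force
    then show ?thesis using 1 assms unfolding path_fun_def by auto
  next
    case 2
    then show ?thesis using assms unfolding path_fun_def by auto
  qed
qed

text \<open>Appending \<open>(i, k)\<close> multiplies the weight of a shorter path by its inverse
  hook length. The conventions in column 0 and below the diagram make this hold at the boundary
  too.\<close>

lemma path_sum_rec:
  assumes "is_partition lam" "(i, k) \<in> diagram lam"
  shows "real (hook lam (i, k)) * path_sum lam i k = path_sum lam i (k - 1) + path_sum lam (i + 1) k"
proof -
  have ik: "1 \<le> i" "1 \<le> k" "k \<le> part lam i" using assms(2) by (auto simp: diagram_iff)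
  have il: "i \<le> length lam" using part_pos_iff[OF assms(1) ik(1)] ik by simp
  let ?u = "\<lambda>e. e(i := k)"
  let ?A = "path_fun lam i (k - 1)" and ?B = "path_fun lam (i + 1) k"
  let ?W = "\<lambda>i e. \<Prod>c\<in>path_cells lam i e. 1 / real (hook lam c)"
  let ?h = "real (hook lam (i, k))"
  have A1: "e (i + 1) \<le> k - 1" if "e \<in> ?A" for e
    using path_funD(2,4)[OF that] il by force
  have B1: "e (i + 1) = k" if "e \<in> ?B" for e
    using path_funD(2)[OF that] .
  have disj: "?u ` ?A \<inter> ?u ` ?B = {}"
  proof -
    have "False" if "a \<in> ?A" "b \<in> ?B" "?u a = ?u b" for a b
      using A1[OF that(1)] B1[OF that(2)] fun_cong[OF that(3), of "i + 1"] ik by simp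
    then show ?thesis by blast
  qed
  \<comment> \<open>The overwritten value at \<open>i\<close> is constant on each family,
    \<open>k - 1\<close> or 0, so it can be recovered.\<close>
  have inj: "inj_on ?u (path_fun lam i' k')" if "\<And>e. e \<in> path_fun lam i' k' \<Longrightarrow> e i = x" for i' k' x
  proof (rule inj_onI)
    fix a b assume "a \<in> path_fun lam i' k'" "b \<in> path_fun lam i' k'" "?u a = ?u b"
    then show "a = b" using that by (metis fun_upd_triv fun_upd_upd)
  qed
  have injA: "inj_on ?u ?A" by (rule inj[of _ _ "k - 1"]) (rule path_funD(2))
  have injB: "inj_on ?u ?B" by (rule inj[of _ _ 0]) (erule path_funD(1), simp)
  have WA: "?W i (?u e) = 1 / ?h * ?W i e" if "e \<in> ?A" for e
  proof -
    have "path_cells lam i (?u e) = insert (i, k) (path_cells lam i e)"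
    proof (rule set_eqI, clarify)
      fix r c
      show "(r, c) \<in> path_cells lam i (?u e) \<longleftrightarrow> (r, c) \<in> insert (i, k) (path_cells lam i e)"
        using A1[OF that] path_funD(2)[OF that] ik il by (cases "r = i") (auto simp: path_cells_def)
    qed
    moreover have "(i, k) \<notin> path_cells lam i e"
      using path_funD(2)[OF that] ik by (auto simp: path_cells_def)
    ultimately show ?thesis using finite_path_cells[OF ik(1) that] by simp
  qed
  have WB: "?W i (?u e) = 1 / ?h * ?W (i + 1) e" if "e \<in> ?B" for e
  proof -
    have "path_cells lam i (?u e) = insert (i, k) (path_cells lam (i + 1) e)"
    proof (rule set_eqI, clarify)
      fix r c
      show "(r, c) \<in> path_cells lam i (?u e) \<longleftrightarrow> (r, c) \<in> insert (i, k) (path_cells lam (i + 1) e)"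
        using B1[OF that] ik il by (cases "r = i") (auto simp: path_cells_def)
    qed
    moreover have "(i, k) \<notin> path_cells lam (i + 1) e" by (auto simp: path_cells_def)
    ultimately show ?thesis using finite_path_cells[OF _ that] by simp
  qed
  have "path_sum lam i k = sum (?W i) (?u ` ?A) + sum (?W i) (?u ` ?B)"
    unfolding path_sum_def path_fun_rec[OF il ik(2,3)]
    using disj ik(1) by (intro sum.union_disjoint finite_imageI finite_path_fun) auto
  also have "sum (?W i) (?u ` ?A) = (\<Sum>e\<in>?A. 1 / ?h * ?W i e)"
    unfolding sum.reindex[OF injA] by (rule sum.cong) (simp_all only: o_apply WA)
  also have "sum (?W i) (?u ` ?B) = (\<Sum>e\<in>?B. 1 / ?h * ?W (i + 1) e)"
    unfolding sum.reindex[OF injB] by (rule sum.cong) (simp_all only: o_apply WB)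
  finally have "path_sum lam i k = 1 / ?h * (path_sum lam i (k - 1) + path_sum lam (i + 1) k)"
    unfolding path_sum_def sum_distrib_left[symmetric] by (simp only: distrib_left)
  then show ?thesis using hook_pos[OF assms] by simp
qed

section \<open>Comparison of neighbouring path sums\<close>

text \<open>Write A for arm plus one and L for the leg of \<open>(i, k)\<close>. Adding A G(i,k-1)
  or L G(i+1,k) to both sides and using the recursion gives two equivalent forms, G(i,k-1) < A
  G(i,k) and L G(i,k) < G(i+1,k). The first, in row 2, is what the theorem needs; both drive the
  induction.\<close>

lemma arm_leg_path_sum_less:
  assumes lam: "is_partition lam" and "1 \<le> k" "1 \<le> i" "i + 1 \<le> conj_part lam k"
  shows "real (conj_part lam k - i) * path_sum lam i (k - 1)
       < real (part lam i - k + 1) * path_sum lam (i + 1) k"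
  using assms(2-4)
proof (induction k arbitrary: i rule: dec_induct)
  case base
  have "(i + 1, 1) \<in> diagram lam" using base diagram_column[OF lam, of 1 "i + 1"] by simp
  then have "i \<le> length lam" using part_pos_iff[OF lam, of "i + 1"] by (simp add: diagram_iff)
  then show ?case using path_sum_first_column_pos[OF lam, of "i + 1"] by (simp add: path_sum_0)
next
  case (step k)
  let ?L = "part lam" and ?T = "conj_part lam" and ?S = "path_sum lam"
  from step.prems show ?case
  proof (induction "?T (Suc k) - i" arbitrary: i rule: less_induct)
    case less
    \<comment> \<open>At \<open>(i, Suc k)\<close> the leg is \<open>l\<close> and arm plus one is
      \<open>a\<close>; at \<open>(i, k)\<close> these are \<open>l'\<close> and
      \<open>a + 1\<close>; at \<open>(i + 1, Suc k)\<close> they are \<open>l - 1\<close> and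
      \<open>a2\<close>.\<close>
    define l where "l = real (?T (Suc k) - i)"
    define l' where "l' = real (?T k - i)"
    define a where "a = real (?L i - k)"
    define a2 where "a2 = real (?L (i + 1) - k)"
    have c2: "(i + 1, Suc k) \<in> diagram lam"
      using less.prems diagram_column[OF lam, of "Suc k" "i + 1"] by simp
    then have c1: "(i, k) \<in> diagram lam" "(i, Suc k) \<in> diagram lam" "(i + 1, k) \<in> diagram lam"
      using diagram_downset[OF lam c2] less.prems step.hyps by auto
    have "?T (Suc k) \<le> ?T k"
      using diagram_downset[OF lam, of "?T (Suc k)" "Suc k" "?T (Suc k)" k] less.prems step.hyps
        diagram_column[OF lam, of "Suc k" "?T (Suc k)"] diagram_column[OF lam, of k "?T (Suc k)"] by simp
    then have l: "1 \<le> l" "l \<le> l'" using less.prems unfolding l_def l'_def by auto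
    have a: "1 \<le> a2" "a2 \<le> a"
      using c2 part_antimono[OF lam less.prems(1), of "i + 1"] unfolding a_def a2_def by (auto simp: diagram_iff)
    have nonneg: "0 \<le> ?S i' k'" if "1 \<le> i'" for i' k' using path_sum_nonneg[OF lam that] .
    \<comment> \<open>The weak inequality also covers the bottom cell of the column, where
      \<open>l = 1\<close> makes the left side vanish.\<close>
    have IH: "(l - 1) * ?S (i + 1) k \<le> a2 * ?S (i + 2) (Suc k)"
    proof (cases "i + 2 \<le> ?T (Suc k)")
      case True
      then have "l - 1 = real (?T (Suc k) - (i + 1))" unfolding l_def by (simp add: of_nat_diff)
      moreover have "a2 = real (?L (i + 1) - Suc k + 1)"
        using c2 unfolding a2_def by (simp add: diagram_iff)
      moreover have "real (?T (Suc k) - (i + 1)) * ?S (i + 1) k < real (?L (i + 1) - Suc k + 1) * ?S (i + 2) (Suc k)"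
        using less.hyps[of "i + 1"] True less.prems by simp
      ultimately show ?thesis by (simp only: less_imp_le)
    next
      case False
      then have "l = 1" using less.prems unfolding l_def by (simp add: of_nat_diff)
      then show ?thesis using a nonneg[of "i + 2" "Suc k"] by simp
    qed
    have "real (hook lam (i + 1, Suc k)) = a2 + (l - 1)"
      using hook_eq[OF lam c2] c2 less.prems unfolding a2_def l_def by (simp add: diagram_iff of_nat_diff)
    then have rec2: "(a2 + (l - 1)) * ?S (i + 1) (Suc k) = ?S (i + 1) k + ?S (i + 2) (Suc k)"
      using path_sum_rec[OF lam c2] by simp
    \<comment> \<open>Adding \<open>a2 * ?S (i + 1) k\<close> to both sides of \<open>IH\<close>
      produces the hook length of \<open>(i + 1, Suc k)\<close> on the left; by \<open>rec2\<close>
      it cancels.\<close>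
    have "(a2 + (l - 1)) * ?S (i + 1) k \<le> a2 * (?S (i + 1) k + ?S (i + 2) (Suc k))"
      using IH by (simp add: algebra_simps)
    also have "\<dots> = (a2 + (l - 1)) * (a2 * ?S (i + 1) (Suc k))"
      unfolding rec2[symmetric] by simp
    finally have "?S (i + 1) k \<le> a2 * ?S (i + 1) (Suc k)"
      using a l by (simp add: mult_le_cancel_left)
    also have "\<dots> \<le> a * ?S (i + 1) (Suc k)" using a nonneg by (intro mult_right_mono) auto
    finally have up: "?S (i + 1) k \<le> a * ?S (i + 1) (Suc k)" .
    have ak: "real (?L i - k + 1) = a + 1" unfolding a_def by simp
    have "i + 1 \<le> ?T k" using less.prems \<open>?T (Suc k) \<le> ?T k\<close> by simp
    then have IH1: "l' * ?S i (k - 1) < (a + 1) * ?S (i + 1) k"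
      using step.IH[OF less.prems(1)] unfolding l'_def ak[symmetric] by blast
    have "real (hook lam (i, k)) = a + 1 + l'"
      using hook_eq[OF lam c1(1)] ak unfolding l'_def by simp
    then have rec1: "(a + 1 + l') * ?S i k = ?S i (k - 1) + ?S (i + 1) k"
      using path_sum_rec[OF lam c1(1)] by simp
    \<comment> \<open>Likewise, adding \<open>l' * ?S (i + 1) k\<close> to both sides of
      \<open>IH1\<close> produces the hook length of \<open>(i, k)\<close>. Strictness enters
      here.\<close>
    have "(a + 1 + l') * (l' * ?S i k) = l' * (?S i (k - 1) + ?S (i + 1) k)"
      unfolding rec1[symmetric] by simp
    also have "\<dots> < (a + 1 + l') * ?S (i + 1) k" using IH1 by (simp add: algebra_simps)
    finally have "l' * ?S i k < ?S (i + 1) k"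
      using a l by (simp add: mult_less_cancel_left)
    moreover have "l * ?S i k \<le> l' * ?S i k" using l nonneg[OF less.prems(1)] by (intro mult_right_mono) auto
    ultimately have "l * ?S i k < a * ?S (i + 1) (Suc k)" using up by linarith
    moreover have "a = real (?L i - Suc k + 1)"
      using c1(2) unfolding a_def by (simp add: diagram_iff)
    ultimately show ?case unfolding l_def by simp
  qed
qed

section \<open>Naruse-Newton coefficients as path sums\<close>

lemma NN_coeff_eq_path_sum:
  assumes I: "is_descent_set I" and j: "j \<le> sI I"
  shows "real (NN_coeff I j) = (\<Prod>c\<in>{c \<in> diagram (lamI I). fst c \<noteq> 1}. real (hook (lamI I) c))
     * path_sum (lamI I) 2 (part (lamI I) 1 - j)"
proof -
  let ?lam = "lamI I" and ?s = "sI I"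
  let ?m = "part ?lam 1" and ?P = "path_cells ?lam"
  let ?k = "?m - j"
  let ?u = "\<lambda>e. e(1 := ?m) :: nat \<Rightarrow> nat"
  let ?D = "\<lambda>e. diagram ?lam - ?P 1 (?u e)"
  define A where "A = {c \<in> diagram ?lam. fst c \<noteq> 1}"
  note lam = lamI_props[OF I]
  have m: "1 \<le> ?m" using lam part_pos_iff[OF lam(1), of 1] by simp
  have k: "1 \<le> ?k" "?k \<le> ?m" using j m unfolding sI_def by auto
  have row1: "card {c \<in> diagram ?lam - ?P 1 e. fst c = 1} = e 2 - 1" if e: "e \<in> path_fun ?lam 1 ?m" for e
  proof -
    have "1 \<le> e 2" "e 2 \<le> ?m" "e 1 = ?m"
      using path_fun_pos[OF e, of 2] path_fun_antimono[OF e, of 1 2] path_funD(2)[OF e] by auto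
    \<comment> \<open>In row 1 the path occupies the columns from \<open>e 2\<close> to
      \<open>?m\<close>.\<close>
    then have "{c \<in> diagram ?lam - ?P 1 e. fst c = 1} = {1} \<times> {1..<e 2}"
      using lam(3) by (auto simp: path_cells_def diagram_iff numeral_2_eq_2)
    then show ?thesis by simp
  qed
  \<comment> \<open>Once the entry column into row 1 is fixed, the path is determined by its part
    below row 1; only the value at row 1 has to be reset.\<close>
  have restrict: "{e \<in> path_fun ?lam 1 ?m. e 2 = ?k} = ?u ` path_fun ?lam 2 ?k"
  proof (intro equalityI subsetI)
    fix e assume "e \<in> {e \<in> path_fun ?lam 1 ?m. e 2 = ?k}"
    then have e: "e \<in> path_fun ?lam 1 ?m" "e 2 = ?k" by auto
    have "e(1 := 0) \<in> path_fun ?lam 2 ?k"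
      using e lam(3) unfolding path_fun_def by (auto simp: less_Suc_eq numeral_2_eq_2)
    moreover have "e = ?u (e(1 := 0))" using path_funD(2)[OF e(1)] by auto
    ultimately show "e \<in> ?u ` path_fun ?lam 2 ?k" by blast
  next
    fix e assume "e \<in> ?u ` path_fun ?lam 2 ?k"
    then obtain f where f: "e = ?u f" "f \<in> path_fun ?lam 2 ?k" by blast
    have "f 0 = 0" "f 2 = ?k" using path_funD(1,2)[OF f(2)] by auto
    then show "e \<in> {e \<in> path_fun ?lam 1 ?m. e 2 = ?k}"
      using f lam(3) k unfolding path_fun_def
      by (auto simp: numeral_2_eq_2 Suc_le_eq le_less_Suc_eq)
  qed
  have "excited ?lam (muI I) = (\<lambda>e. diagram ?lam - ?P 1 e) ` path_fun ?lam 1 ?m"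
    using lam by (intro excited_eq_path_complements diagram_muI[OF I]) auto
  then have "{D \<in> excited ?lam (muI I). card {c \<in> D. fst c = 1} = ?s - j}
      = (\<lambda>e. diagram ?lam - ?P 1 e) ` {e \<in> path_fun ?lam 1 ?m. card {c \<in> diagram ?lam - ?P 1 e. fst c = 1} = ?s - j}"
    by (simp only: Compr_image_eq)
  also have "{e \<in> path_fun ?lam 1 ?m. card {c \<in> diagram ?lam - ?P 1 e. fst c = 1} = ?s - j}
      = {e \<in> path_fun ?lam 1 ?m. e 2 = ?k}"
  proof -
    \<comment> \<open>Both subtractions are exact, since \<open>1 \<le> e 2\<close> and
      \<open>?s = ?m - 1\<close>.\<close>
    have "e 2 - 1 = ?s - j \<longleftrightarrow> e 2 = ?k" if "e \<in> path_fun ?lam 1 ?m" for e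
      using path_fun_pos[OF that, of 2] k unfolding sI_def by auto
    then show ?thesis using row1 by (intro Collect_cong conj_cong) auto
  qed
  finally have exc: "{D \<in> excited ?lam (muI I). card {c \<in> D. fst c = 1} = ?s - j} = ?D ` path_fun ?lam 2 ?k"
    unfolding restrict image_image .
  have inj: "inj_on ?D (path_fun ?lam 2 ?k)"
  proof (rule inj_onI)
    fix e f assume ef: "e \<in> path_fun ?lam 2 ?k" "f \<in> path_fun ?lam 2 ?k" "?D e = ?D f"
    then have uu: "?u e \<in> path_fun ?lam 1 ?m" "?u f \<in> path_fun ?lam 1 ?m" using restrict by blast+
    then have "?P 1 (?u e) = ?P 1 (?u f)"
      using ef(3) path_cells_subset_diagram[of 1] by (metis double_diff le_numeral_extra(4) subset_refl)
    then have "?u e = ?u f" using path_cells_inj[OF _ uu] by simp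
    moreover have "e 1 = f 1" using path_funD(1)[OF ef(1), of 1] path_funD(1)[OF ef(2), of 1] by simp
    ultimately show "e = f" by (metis fun_upd_triv fun_upd_upd)
  qed
  have weight: "real (\<Prod>c\<in>{c \<in> ?D e. fst c \<noteq> 1}. hook ?lam c)
      = (\<Prod>c\<in>A. real (hook ?lam c)) * (\<Prod>c\<in>?P 2 e. 1 / real (hook ?lam c))"
    if e: "e \<in> path_fun ?lam 2 ?k" for e
  proof -
    have sub: "?P 2 e \<subseteq> A" using path_cells_subset_diagram[OF _ e] unfolding A_def by (auto simp: path_cells_def)
    have fin: "finite A" using finite_diagram[of ?lam] unfolding A_def by simp
    have "{c \<in> ?D e. fst c \<noteq> 1} = A - ?P 2 e"
    proof (rule set_eqI, clarify)
      fix r c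
      show "(r, c) \<in> {c \<in> ?D e. fst c \<noteq> 1} \<longleftrightarrow> (r, c) \<in> A - ?P 2 e"
        using diagram_pos[of r c ?lam] by (auto simp: A_def path_cells_def)
    qed
    moreover have "(\<Prod>c\<in>?P 2 e. real (hook ?lam c)) \<noteq> 0"
      using sub fin hook_pos[OF lam(1)] by (subst prod_zero_iff) (auto simp: A_def intro: finite_subset)
    ultimately show ?thesis
      using prod.subset_diff[OF sub fin, of "\<lambda>c. real (hook ?lam c)"]
      by (simp add: prod_dividef)
  qed
  have "real (NN_coeff I j) = (\<Sum>e\<in>path_fun ?lam 2 ?k. real (\<Prod>c\<in>{c \<in> ?D e. fst c \<noteq> 1}. hook ?lam c))"
    unfolding NN_coeff_def exc sum.reindex[OF inj] o_def of_nat_sum ..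
  also have "\<dots> = (\<Sum>e\<in>path_fun ?lam 2 ?k. (\<Prod>c\<in>A. real (hook ?lam c)) * (\<Prod>c\<in>?P 2 e. 1 / real (hook ?lam c)))"
    by (rule sum.cong[OF refl weight])
  finally show ?thesis unfolding path_sum_def sum_distrib_left A_def .
qed

text \<open>A column has length 2 exactly when it meets row 2 but not row 3, and row 2 is as long as
  row 1.\<close>

lemma wI_eq:
  assumes "is_descent_set I"
  shows "wI I = part (lamI I) 1 - part (lamI I) 3"
proof -
  let ?lam = "lamI I"
  note lam = lamI_props[OF assms]
  have m: "1 \<le> part ?lam 1" using lam part_pos_iff[OF lam(1), of 1] by simp
  have "{j. 1 \<le> j \<and> j \<le> sI I + 1 \<and> conj_part ?lam j = 2} = {part ?lam 3<..part ?lam 1}"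
  proof (rule set_eqI)
    fix j
    have "conj_part ?lam j = 2 \<longleftrightarrow> j \<le> part ?lam 2 \<and> \<not> j \<le> part ?lam 3" if "1 \<le> j"
    proof -
      have "conj_part ?lam j = 2 \<longleftrightarrow> (2, j) \<in> diagram ?lam \<and> (3, j) \<notin> diagram ?lam"
        using diagram_column[OF lam(1) that, of 2] diagram_column[OF lam(1) that, of 3] by auto
      then show ?thesis using that by (simp add: diagram_iff)
    qed
    then show "j \<in> {j. 1 \<le> j \<and> j \<le> sI I + 1 \<and> conj_part ?lam j = 2} \<longleftrightarrow> j \<in> {part ?lam 3<..part ?lam 1}"
      using m lam(2) unfolding sI_def by auto
  qed
  then show ?thesis unfolding wI_def by simp
qed

theorem theorem4p5:
  fixes I :: "nat set"
  assumes "is_descent_set I"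
  shows "(\<forall>j. j < min (wI I) (sI I) \<longrightarrow>
            real (NN_coeff I j) / fact j = real (NN_coeff I (j + 1)) / fact (j + 1))
       \<and> (\<forall>j. wI I \<le> j \<and> j < sI I \<longrightarrow>
            real (NN_coeff I j) / fact j > real (NN_coeff I (j + 1)) / fact (j + 1))"
proof -
  let ?lam = "lamI I"
  let ?m = "part ?lam 1" and ?S = "path_sum ?lam 2"
  note lam = lamI_props[OF assms]
  define H where "H = (\<Prod>c\<in>{c \<in> diagram ?lam. fst c \<noteq> 1}. real (hook ?lam c))"
  have "0 < H" unfolding H_def using hook_pos[OF lam(1)] by (intro prod_pos) auto
  \<comment> \<open>The cell \<open>(2, ?m - j)\<close> has arm \<open>j\<close>, so its hook length
    is \<open>j + 1\<close> plus its leg. With the common factor \<open>H / fact (j + 1)\<close>,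
    the claim compares \<open>(j + 1) * ?S (?m - j)\<close> with
    \<open>?S (?m - j - 1)\<close>.\<close>
  have facts: "real (NN_coeff I j) / fact j = H / fact (j + 1) * (real (j + 1) * ?S (?m - j))"
      "real (NN_coeff I (j + 1)) / fact (j + 1) = H / fact (j + 1) * ?S (?m - j - 1)"
      "real (hook ?lam (2, ?m - j)) = real (j + 1) + real (conj_part ?lam (?m - j) - 2)"
      "real (hook ?lam (2, ?m - j)) * ?S (?m - j) = ?S (?m - j - 1) + path_sum ?lam 3 (?m - j)"
      "2 \<le> ?m - j" "2 \<le> conj_part ?lam (?m - j)"
      "?m - j \<le> part ?lam 3 \<longleftrightarrow> 3 \<le> conj_part ?lam (?m - j)"
      "part ?lam 2 - (?m - j) + 1 = j + 1"
    if j: "j < sI I" for j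
  proof -
    show m: "2 \<le> ?m - j" using j unfolding sI_def by simp
    then have c: "(2, ?m - j) \<in> diagram ?lam" using lam(2) by (simp add: diagram_iff)
    show "real (NN_coeff I j) / fact j = H / fact (j + 1) * (real (j + 1) * ?S (?m - j))"
    proof -
      have "real (NN_coeff I j) = H * ?S (?m - j)"
        using NN_coeff_eq_path_sum[OF assms, of j] j unfolding H_def by simp
      then show ?thesis by (simp add: divide_simps)
    qed
    show "real (NN_coeff I (j + 1)) / fact (j + 1) = H / fact (j + 1) * ?S (?m - j - 1)"
      using NN_coeff_eq_path_sum[OF assms, of "j + 1"] j unfolding H_def by simp
    show arm: "part ?lam 2 - (?m - j) + 1 = j + 1" using lam(2) m by simp
    show "real (hook ?lam (2, ?m - j)) = real (j + 1) + real (conj_part ?lam (?m - j) - 2)"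
      unfolding hook_eq[OF lam(1) c] arm by simp
    show "real (hook ?lam (2, ?m - j)) * ?S (?m - j) = ?S (?m - j - 1) + path_sum ?lam 3 (?m - j)"
      using path_sum_rec[OF lam(1) c] by simp
    show "2 \<le> conj_part ?lam (?m - j)"
      using c m diagram_column[OF lam(1), of "?m - j" 2] by simp
    show "?m - j \<le> part ?lam 3 \<longleftrightarrow> 3 \<le> conj_part ?lam (?m - j)"
      using m diagram_column[OF lam(1), of "?m - j" 3] by (simp add: diagram_iff)
  qed
  show ?thesis
  proof (intro conjI allI impI)
    fix j assume "j < min (wI I) (sI I)"
    then have j: "j < sI I" "j < wI I" by auto
    note f = facts[OF j(1)]
    \<comment> \<open>The cell below \<open>(2, ?m - j)\<close> is missing, so both the leg and the
      lower term of the recursion vanish.\<close>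
    have out: "part ?lam 3 < ?m - j" using j(2) unfolding wI_eq[OF assms] by simp
    then have "conj_part ?lam (?m - j) = 2" using f(6,7) by simp
    moreover have "path_sum ?lam 3 (?m - j) = 0" by (rule path_sum_outside[OF f(5) out])
    ultimately have "real (j + 1) * ?S (?m - j) = ?S (?m - j - 1)" using f(3,4) by simp
    then show "real (NN_coeff I j) / fact j = real (NN_coeff I (j + 1)) / fact (j + 1)"
      unfolding f(1,2) by simp
  next
    fix j assume "wI I \<le> j \<and> j < sI I"
    then have j: "j < sI I" "wI I \<le> j" by auto
    note f = facts[OF j(1)]
    have three: "3 \<le> conj_part ?lam (?m - j)" using j(2) f(7) unfolding wI_eq[OF assms] by linarith
    define l where "l = real (conj_part ?lam (?m - j) - 2)"
    define a where "a = real (j + 1)"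
    have "l * ?S (?m - j - 1) < a * path_sum ?lam 3 (?m - j)"
      using arm_leg_path_sum_less[OF lam(1), of "?m - j" 2] f(5) three f(8) unfolding l_def a_def by simp
    \<comment> \<open>Adding \<open>a * ?S (?m - j - 1)\<close> to both sides makes the hook length
      of \<open>(2, ?m - j)\<close> a common factor.\<close>
    then have "(a + l) * ?S (?m - j - 1) < a * (?S (?m - j - 1) + path_sum ?lam 3 (?m - j))"
      by (simp add: algebra_simps)
    also have "\<dots> = (a + l) * (a * ?S (?m - j))"
      unfolding f(4)[symmetric] f(3) a_def l_def by simp
    finally have "?S (?m - j - 1) < a * ?S (?m - j)"
      by (rule mult_less_cancel_left_pos[THEN iffD1, rotated]) (simp add: a_def l_def add_pos_nonneg)
    then show "real (NN_coeff I (j + 1)) / fact (j + 1) < real (NN_coeff I j) / fact j"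
      unfolding f(1,2) a_def using \<open>0 < H\<close> by (intro mult_strict_left_mono) auto
  qed
qed

end
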